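(* Let $D$ be the derivation on Laurent polynomials in the commuting variables $a,x,z,v,u$ determined by $D(a)=axv$, $D(x)=xvz$, $D(z)=vz^2$, $D(v)=uv^2z$, $D(u)=u^2vz$ (extended by linearity and the Leibniz rule), and let $\mathrm{Gen}(a,t)=\sum_{n\ge0}D^n(a)\frac{t^n}{n!}$. Let $y$ be the solution, a formal power series in $t$ with zero constant term (with coefficients depending on $u,v,z$), of the equation $$(1-u^{-1}+y)\,u\,e^{-y}=u-1+vzt.$$ Then $$\mathrm{Gen}(a,t)=a\,e^{xz^{-1}y}.$$ *)

theory Defs
  imports Complex_Main "HOL-Library.Poly_Mapping" "HOL-Computational_Algebra.Formal_Power_Series"
begin

datatype lvar = Va | Vx | Vz | Vv | Vu

text \<open>The linear order on the variables is irrelevant to the mathematics; it only makes the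
  instance \<open>idom\<close> of \<open>poly_mapping\<close> available for Laurent polynomials.\<close>

primrec lvar_rank :: "lvar \<Rightarrow> nat" where
  "lvar_rank Va = 0"
| "lvar_rank Vx = 1"
| "lvar_rank Vz = 2"
| "lvar_rank Vv = 3"
| "lvar_rank Vu = 4"

lemma lvar_rank_inject: "lvar_rank i = lvar_rank j \<longleftrightarrow> i = j"
  by (cases i; cases j) simp_all

instantiation lvar :: linorder
begin

definition "i \<le> j \<longleftrightarrow> lvar_rank i \<le> lvar_rank j"
definition "i < j \<longleftrightarrow> lvar_rank i < lvar_rank j"

instance
  by intro_classes (auto simp: less_eq_lvar_def less_lvar_def lvar_rank_inject)

end

text \<open>A Laurent polynomial is a finitely supported map from exponent vectors, with integer
  entries, to coefficients; the product of \<open>poly_mapping\<close> is convolution.\<close>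

type_synonym 'k laurent = "(lvar \<Rightarrow>\<^sub>0 int) \<Rightarrow>\<^sub>0 'k"

definition lconst :: "'k \<Rightarrow> 'k::field_char_0 laurent" where
  "lconst c = Poly_Mapping.single 0 c"

definition lpow :: "lvar \<Rightarrow> int \<Rightarrow> 'k::field_char_0 laurent" where
  "lpow i k = Poly_Mapping.single (Poly_Mapping.single i k) 1"

abbreviation lvar :: "lvar \<Rightarrow> 'k::field_char_0 laurent" where
  "lvar i \<equiv> lpow i 1"

abbreviation linv :: "lvar \<Rightarrow> 'k::field_char_0 laurent" where
  "linv i \<equiv> lpow i (-1)"

definition is_derivation :: "('k::field_char_0 laurent \<Rightarrow> 'k laurent) \<Rightarrow> bool" where
  "is_derivation D \<longleftrightarrow>
     (\<forall>f g. D (f + g) = D f + D g) \<and>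
     (\<forall>c f. D (lconst c * f) = lconst c * D f) \<and>
     (\<forall>f g. D (f * g) = D f * g + f * D g)"

definition is_grammar_derivation :: "('k::field_char_0 laurent \<Rightarrow> 'k laurent) \<Rightarrow> bool" where
  "is_grammar_derivation D \<longleftrightarrow> is_derivation D \<and>
     D (lvar Va) = lvar Va * lvar Vx * lvar Vv \<and>
     D (lvar Vx) = lvar Vx * lvar Vv * lvar Vz \<and>
     D (lvar Vz) = lvar Vv * (lvar Vz)^2 \<and>
     D (lvar Vv) = lvar Vu * (lvar Vv)^2 * lvar Vz \<and>
     D (lvar Vu) = (lvar Vu)^2 * lvar Vv * lvar Vz"

definition Gen :: "('k::field_char_0 laurent \<Rightarrow> 'k laurent) \<Rightarrow> 'k laurent \<Rightarrow> 'k laurent fps" where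
  "Gen D w = Abs_fps (\<lambda>n. lconst (1 / fact n) * (D ^^ n) w)"

text \<open>The library's \<open>fps_exp\<close> needs coefficients in a field, whence this version
  \<open>\<Sum>n. f^n / n!\<close>; it is meaningful for \<open>f\<close> with zero constant term only.\<close>

definition lexp :: "'k::field_char_0 laurent fps \<Rightarrow> 'k laurent fps" where
  "lexp f = Abs_fps (\<lambda>n. lconst (1 / fact n)) oo f"

definition only_uvz :: "'k::field_char_0 laurent \<Rightarrow> bool" where
  "only_uvz f \<longleftrightarrow> (\<forall>e \<in> Poly_Mapping.keys f.
     Poly_Mapping.lookup e Va = 0 \<and> Poly_Mapping.lookup e Vx = 0)"

definition is_solution :: "'k::field_char_0 laurent fps \<Rightarrow> bool" where
  "is_solution y \<longleftrightarrow>
     fps_nth y 0 = 0 \<and>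
     (\<forall>n. only_uvz (fps_nth y n)) \<and>
     (fps_const (1 - linv Vu) + y) * fps_const (lvar Vu) * lexp (- y)
       = fps_const (lvar Vu - 1) + fps_const (lvar Vv * lvar Vz) * fps_X"


subsection \<open>Existence and uniqueness of the derivation\<close>

lemma lconst_add: "lconst (c + d) = lconst c + lconst d"
  by (simp add: lconst_def single_add)

lemma lconst_mult: "lconst (c * d) = lconst c * lconst d"
  by (simp add: lconst_def mult_single)

lemma lconst_0 [simp]: "lconst 0 = 0"
  by (simp add: lconst_def)

lemma lconst_1 [simp]: "lconst 1 = 1"
  by (simp add: lconst_def)

abbreviation lmono :: "(lvar \<Rightarrow>\<^sub>0 int) \<Rightarrow> 'k::field_char_0 laurent" where
  "lmono e \<equiv> Poly_Mapping.single e 1"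

lemma lmono_add: "lmono (d + e) = lmono d * lmono e"
  by (simp add: mult_single)

lemma single_eq: "Poly_Mapping.single e c = lconst c * lmono e"
  by (simp add: lconst_def mult_single)

lemma laurent_induct [case_names mono add]:
  assumes "\<And>c e. P (lconst c * lmono e)"
    and "\<And>f g. P f \<Longrightarrow> P g \<Longrightarrow> P (f + g)"
  shows "P f"
proof (induction f rule: update_induct)
  case const
  show ?case using assms(1)[of 0] by simp
next
  case (update f a b)
  have "Poly_Mapping.update a b f = f + Poly_Mapping.single a b"
    using update.hyps
    by (intro poly_mapping_eqI)
       (auto simp: lookup_update lookup_add lookup_single in_keys_iff when_def)
  then show ?case
    using assms(2)[OF update.IH assms(1)[of b a]] by (simp only: single_eq[of a b])
qed

text \<open>The derivation with \<open>D i = G i\<close> for every variable \<open>i\<close>, first on monomials.\<close>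

definition dmono :: "(lvar \<Rightarrow> 'k::field_char_0 laurent) \<Rightarrow> (lvar \<Rightarrow>\<^sub>0 int) \<Rightarrow> 'k laurent" where
  "dmono G e = (\<Sum>i \<in> {Va, Vx, Vz, Vv, Vu}.
     lconst (of_int (Poly_Mapping.lookup e i)) * lmono (e - Poly_Mapping.single i 1) * G i)"

definition dext :: "(lvar \<Rightarrow> 'k::field_char_0 laurent) \<Rightarrow> 'k laurent \<Rightarrow> 'k laurent" where
  "dext G f = (\<Sum>e \<in> Poly_Mapping.keys f. lconst (Poly_Mapping.lookup f e) * dmono G e)"

lemma dext_superset:
  assumes "finite S" "Poly_Mapping.keys f \<subseteq> S"
  shows "dext G f = (\<Sum>e \<in> S. lconst (Poly_Mapping.lookup f e) * dmono G e)"
  unfolding dext_def using assms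
  by (intro sum.mono_neutral_left) (auto simp: in_keys_iff)

lemma dext_add: "dext G (f + g) = dext G f + dext G g"
proof -
  let ?S = "Poly_Mapping.keys f \<union> Poly_Mapping.keys g"
  have S: "finite ?S" by simp
  have "Poly_Mapping.keys (f + g) \<subseteq> ?S" by (rule Poly_Mapping.keys_add)
  then show ?thesis
    using S dext_superset[OF S, of "f + g" G] dext_superset[OF S, of f G] dext_superset[OF S, of g G]
    by (simp add: lookup_add lconst_add distrib_right sum.distrib)
qed

lemma dext_mono: "dext G (lconst c * lmono e) = lconst c * dmono G e"
  by (subst dext_superset[of "{e}"]) (auto simp: lconst_def mult_single)

lemma dext_scale: "dext G (lconst c * f) = lconst c * dext G f"
proof (induction f rule: laurent_induct)
  case (mono d e)
  show ?case
    using dext_mono[of G "c * d" e] by (simp add: dext_mono lconst_mult mult.assoc)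
qed (simp add: dext_add distrib_left)

lemma lmono_shift: "lmono (d + e - s) = lmono (d - s) * lmono e"
  by (simp add: mult_single algebra_simps)

lemma lmono_shift': "lmono (d + e - s) = lmono d * lmono (e - s)"
  by (simp add: mult_single algebra_simps)

lemma dmono_add: "dmono G (d + e) = dmono G d * lmono e + lmono d * dmono G e"
proof -
  have "lconst (of_int (Poly_Mapping.lookup (d + e) i)) * lmono (d + e - s) * G i
    = lconst (of_int (Poly_Mapping.lookup d i)) * lmono (d - s) * G i * lmono e
    + lmono d * (lconst (of_int (Poly_Mapping.lookup e i)) * lmono (e - s) * G i)" for i s
  proof -
    have "lconst (of_int (Poly_Mapping.lookup (d + e) i)) * lmono (d + e - s) * G i
      = lconst (of_int (Poly_Mapping.lookup d i)) * lmono (d + e - s) * G i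
      + lconst (of_int (Poly_Mapping.lookup e i)) * lmono (d + e - s) * G i"
      by (simp only: lookup_add of_int_add lconst_add distrib_right)
    also have "lconst (of_int (Poly_Mapping.lookup d i)) * lmono (d + e - s) * G i
      = lconst (of_int (Poly_Mapping.lookup d i)) * lmono (d - s) * G i * lmono e"
      unfolding lmono_shift by (simp only: mult.commute mult.left_commute mult.assoc)
    also have "lconst (of_int (Poly_Mapping.lookup e i)) * lmono (d + e - s) * G i
      = lmono d * (lconst (of_int (Poly_Mapping.lookup e i)) * lmono (e - s) * G i)"
      unfolding lmono_shift' by (simp only: mult.commute mult.left_commute mult.assoc)
    finally show ?thesis .
  qed
  then show ?thesis
    unfolding dmono_def by (simp only: sum.distrib sum_distrib_left sum_distrib_right)
qed

lemma dext_mult: "dext G (f * g) = dext G f * g + f * dext G g"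
proof (induction f rule: laurent_induct)
  case (mono c d)
  show ?case
  proof (induction g rule: laurent_induct)
    case (mono c' e)
    have "lconst c * lmono d * (lconst c' * lmono e) = lconst (c * c') * lmono (d + e)"
      by (simp only: lconst_mult lmono_add ac_simps)
    then have "dext G (lconst c * lmono d * (lconst c' * lmono e))
        = lconst (c * c') * dmono G (d + e)"
      by (simp only: dext_mono)
    then show ?case
      by (simp only: dext_mono dmono_add lconst_mult distrib_left ac_simps)
  next
    case (add f g)
    then show ?case by (simp add: dext_add distrib_left)
  qed
next
  case (add f h)
  then show ?case by (simp add: dext_add algebra_simps)
qed

lemma dext_var: "dext G (lvar i) = G i"
proof -
  have "dext G (lvar i) = dmono G (Poly_Mapping.single i 1)"
    using dext_mono[of G 1 "Poly_Mapping.single i 1"] by (simp add: lpow_def)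
  also have "\<dots> = G i"
    by (cases i) (simp_all add: dmono_def lookup_single)
  finally show ?thesis .
qed

lemma derivation_dext: "is_derivation (dext G)"
  unfolding is_derivation_def using dext_add dext_scale dext_mult by blast

lemma lpow_add: "lpow i (j + k) = lpow i j * lpow i k"
  by (simp add: lpow_def mult_single single_add)

lemma lpow_0 [simp]: "lpow i 0 = 1"
  by (simp add: lpow_def)

lemma lmono_split:
  "lmono e = (\<Prod>i \<in> {Va, Vx, Vz, Vv, Vu}. lpow i (Poly_Mapping.lookup e i))"
proof -
  have e: "e = (\<Sum>i \<in> {Va, Vx, Vz, Vv, Vu}. Poly_Mapping.single i (Poly_Mapping.lookup e i))"
  proof (rule poly_mapping_eqI)
    fix k
    show "Poly_Mapping.lookup e k = Poly_Mapping.lookup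
      (\<Sum>i \<in> {Va, Vx, Vz, Vv, Vu}. Poly_Mapping.single i (Poly_Mapping.lookup e i)) k"
      by (cases k) (simp_all add: lookup_add lookup_single)
  qed
  have "lmono (\<Sum>i \<in> S. h i) = (\<Prod>i \<in> S. lmono (h i))" if "finite S" for S and h :: "lvar \<Rightarrow> lvar \<Rightarrow>\<^sub>0 int"
    using that by (induction S) (auto simp: lmono_add)
  note prod = this[of "{Va, Vx, Vz, Vv, Vu}" "\<lambda>i. Poly_Mapping.single i (Poly_Mapping.lookup e i)"]
  have "lmono e = lmono (\<Sum>i \<in> {Va, Vx, Vz, Vv, Vu}. Poly_Mapping.single i (Poly_Mapping.lookup e i))"
    using e by (rule arg_cong)
  also have "\<dots> = (\<Prod>i \<in> {Va, Vx, Vz, Vv, Vu}. lpow i (Poly_Mapping.lookup e i))"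
    unfolding lpow_def by (rule prod) simp
  finally show ?thesis .
qed

lemma derivation_unique:
  fixes D D' :: "'k::field_char_0 laurent \<Rightarrow> 'k laurent"
  assumes D: "is_derivation D" and D': "is_derivation D'"
    and vars: "\<And>i. D (lvar i) = D' (lvar i)"
  shows "D = D'"
proof -
  define E where "E f = D f - D' f" for f
  have add: "E (f + g) = E f + E g" for f g
  proof -
    have "D (f + g) = D f + D g" "D' (f + g) = D' f + D' g"
      using D D' unfolding is_derivation_def by blast+
    then show ?thesis by (simp add: E_def)
  qed
  have scale: "E (lconst c * f) = lconst c * E f" for c f
  proof -
    have "D (lconst c * f) = lconst c * D f" "D' (lconst c * f) = lconst c * D' f"
      using D D' unfolding is_derivation_def by blast+
    then show ?thesis by (simp add: E_def right_diff_distrib)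
  qed
  have mult: "E (f * g) = E f * g + f * E g" for f g
  proof -
    have "D (f * g) = D f * g + f * D g" "D' (f * g) = D' f * g + f * D' g"
      using D D' unfolding is_derivation_def by blast+
    then show ?thesis by (simp add: E_def algebra_simps)
  qed
  have one: "E 1 = 0"
    using mult[of 1 1] by simp
  have var: "E (lvar i) = 0" for i
    by (simp add: E_def vars)
  have inv: "E (linv i) = 0" for i
  proof -
    have 1: "lvar i * linv i = (1 :: 'k laurent)"
      using lpow_add[of i 1 "-1", where ?'a = 'k] by simp
    then have "lvar i * E (linv i) = 0"
      using mult[of "lvar i" "linv i"] one var by simp
    then have "linv i * (lvar i * E (linv i)) = 0" by simp
    moreover have "linv i * (lvar i * E (linv i)) = (lvar i * linv i) * E (linv i)"
      by (simp only: ac_simps)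
    ultimately show ?thesis using 1 by simp
  qed
  have pow: "E (lpow i k) = 0" for i k
  proof (induction k rule: int_induct[of _ 0])
    case base
    then show ?case by (simp add: one)
  next
    case (step1 k)
    then show ?case by (simp add: lpow_add mult var)
  next
    case (step2 k)
    have "lpow i (k - 1) = lpow i k * (linv i :: 'k laurent)"
      using lpow_add[of i k "-1"] by simp
    then show ?case using step2 by (simp add: mult inv)
  qed
  have "E (lmono e) = 0" for e
    by (simp add: lmono_split mult pow)
  then have "E f = 0" for f
    by (induction f rule: laurent_induct) (simp_all add: add scale)
  then show ?thesis
    by (auto simp: E_def)
qed

theorem grammar_derivation_ex1: "\<exists>!D :: 'k::field_char_0 laurent \<Rightarrow> 'k laurent. is_grammar_derivation D"
proof -
  define G :: "lvar \<Rightarrow> 'k laurent" where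
    "G = case_lvar (lvar Va * lvar Vx * lvar Vv) (lvar Vx * lvar Vv * lvar Vz)
       (lvar Vv * (lvar Vz)^2) (lvar Vu * (lvar Vv)^2 * lvar Vz) ((lvar Vu)^2 * lvar Vv * lvar Vz)"
  have "is_grammar_derivation (dext G)"
    by (simp add: is_grammar_derivation_def derivation_dext dext_var) (simp add: G_def)
  moreover have "D (lvar i) = D' (lvar i)"
    if "is_grammar_derivation D" "is_grammar_derivation D'" for D D' :: "'k laurent \<Rightarrow> 'k laurent" and i
    using that by (cases i) (simp_all add: is_grammar_derivation_def)
  ultimately show ?thesis
    using derivation_unique unfolding is_grammar_derivation_def by blast
qed


subsection \<open>Existence and uniqueness of the solution\<close>

context
  includes fps_syntax
begin

lemma fps_power_agree_less:
  fixes y y' :: "'r::comm_ring_1 fps"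
  assumes "\<And>k. k < n \<Longrightarrow> y $ k = y' $ k" "m < n"
  shows "(y ^ i) $ m = (y' ^ i) $ m"
  using assms(2)
proof (induction i arbitrary: m)
  case (Suc i)
  have "y $ k * (y ^ i) $ (m - k) = y' $ k * (y' ^ i) $ (m - k)" if "k \<in> {0..m}" for k
    using that Suc assms(1)[of k] by simp
  then show ?case by (simp add: fps_mult_nth)
qed simp

lemma fps_compose_agree:
  fixes F y y' :: "'r::comm_ring_1 fps"
  assumes agree: "\<And>k. k < n \<Longrightarrow> y $ k = y' $ k" and "y $ 0 = 0" "y' $ 0 = 0" "F $ 1 = 0"
  shows "(F oo y) $ n = (F oo y') $ n"
proof -
  have "(y ^ i) $ n = (y' ^ i) $ n" if "i \<noteq> 1" for i
  proof (cases i)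
    case (Suc j)
    then have j: "j \<noteq> 0" using that by simp
    have "y $ k * (y ^ j) $ (n - k) = y' $ k * (y' ^ j) $ (n - k)" if k: "k \<in> {0..n}" for k
    proof (cases "k = 0 \<or> k = n")
      case True
      then show ?thesis
        using assms(2,3) j by (auto simp: fps_power_zeroth power_0_left)
    next
      case False
      then show ?thesis
        using k agree fps_power_agree_less[of n y y' "n - k" j] by simp
    qed
    then show ?thesis by (simp add: Suc fps_mult_nth)
  qed simp
  then have "F $ i * (y ^ i) $ n = F $ i * (y' ^ i) $ n" for i
    using assms(4) by (cases "i = 1") auto
  then show ?thesis by (simp add: fps_compose_nth)
qed

lemma fps_compose_solve_ex1:
  fixes F w :: "'r::comm_ring_1 fps"
  assumes F: "F $ 1 = 1" "F $ 0 = w $ 0"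
    and S: "0 \<in> S" "1 \<in> S" "\<And>a b. a \<in> S \<Longrightarrow> b \<in> S \<Longrightarrow> a + b \<in> S"
      "\<And>a b. a \<in> S \<Longrightarrow> b \<in> S \<Longrightarrow> a * b \<in> S" "\<And>a b. a \<in> S \<Longrightarrow> b \<in> S \<Longrightarrow> a - b \<in> S"
    and FS: "\<And>n. F $ n \<in> S" and wS: "\<And>n. w $ n \<in> S"
  shows "\<exists>!y. y $ 0 = 0 \<and> (\<forall>n. y $ n \<in> S) \<and> F oo y = w"
proof -
  define H where "H = F - fps_X"
  have H1: "H $ 1 = 0" using F by (simp add: H_def)
  have HS: "H $ n \<in> S" for n
    using FS S by (auto simp: H_def fps_X_def)
  have iff: "F oo y = w \<longleftrightarrow> y = w - (H oo y)" if "y $ 0 = 0" for y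
  proof -
    have "fps_X oo y = y"
      using that by (auto simp: fps_X_fps_compose fps_eq_iff)
    then have "F oo y = (H oo y) + y"
      by (simp add: H_def fps_compose_sub_distrib)
    then show ?thesis by (auto simp: algebra_simps)
  qed
  define Y where "Y k = ((\<lambda>y. w - (H oo y)) ^^ k) 0" for k
  have Y_Suc: "Y (Suc k) = w - (H oo Y k)" for k
    by (simp add: Y_def)
  have Y0: "Y k $ 0 = 0" for k
    by (cases k) (simp_all add: Y_Suc F H_def, simp add: Y_def)
  have sumS: "(\<Sum>i \<in> A. f i) \<in> S" if "\<And>i. i \<in> A \<Longrightarrow> f i \<in> S" for A :: "nat set" and f
    using that by (induction A rule: infinite_finite_induct) (auto intro: S)
  have powS: "(y ^ i) $ n \<in> S" if "\<And>n. y $ n \<in> S" for y i n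
    using that by (induction i arbitrary: n) (auto simp: fps_mult_nth intro!: sumS S)
  have YS: "Y k $ n \<in> S" for k n
  proof (induction k arbitrary: n)
    case 0
    then show ?case by (simp add: Y_def S)
  next
    case (Suc k)
    then show ?case
      by (auto simp: Y_Suc fps_compose_nth intro!: S wS sumS HS powS)
  qed
  have step: "Y (Suc k) $ n = Y k $ n" if "n \<le> k" for k n
    using that
  proof (induction k arbitrary: n)
    case 0
    then show ?case by (simp add: Y0)
  next
    case (Suc k)
    have "(H oo Y (Suc k)) $ n = (H oo Y k) $ n"
      using Suc by (intro fps_compose_agree Y0 H1) auto
    then show ?case by (simp add: Y_Suc)
  qed
  have stable: "Y k $ n = Y n $ n" if "n \<le> k" for k n
    using that by (induction k rule: dec_induct) (auto simp: step)
  define y where "y = Abs_fps (\<lambda>n. Y n $ n)"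
  have y0: "y $ 0 = 0" by (simp add: y_def Y0)
  have "y $ n = (w - (H oo y)) $ n" for n
  proof -
    have "y $ n = Y (Suc n) $ n" by (simp add: y_def step)
    also have "\<dots> = w $ n - (H oo Y n) $ n" by (simp add: Y_Suc)
    also have "(H oo Y n) $ n = (H oo y) $ n"
    proof (intro fps_compose_agree Y0 H1 y0)
      show "Y n $ k = y $ k" if "k < n" for k
        using stable[of k n] that by (simp add: y_def)
    qed
    finally show ?thesis by simp
  qed
  then have "y = w - (H oo y)"
    by (rule fps_ext)
  then have sol: "F oo y = w"
    using iff[OF y0] by (rule iffD2[rotated])
  have uniq: "y1 = y2" if "y1 $ 0 = 0" "y2 $ 0 = 0" "F oo y1 = w" "F oo y2 = w" for y1 y2
  proof (rule fps_ext)
    fix n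
    show "y1 $ n = y2 $ n"
    proof (induction n rule: less_induct)
      case (less n)
      then have "(H oo y1) $ n = (H oo y2) $ n"
        using that H1 by (intro fps_compose_agree) auto
      moreover have "z $ n = w $ n - (H oo z) $ n" if "z $ 0 = 0" "F oo z = w" for z
        using arg_cong[OF iffD1[OF iff[OF that(1)] that(2)], of "\<lambda>f. f $ n"]
        by (simp only: fps_sub_nth)
      note this[OF that(1) that(3)] this[OF that(2) that(4)]
      ultimately show ?case
        by simp
    qed
  qed
  show ?thesis
    using y0 sol uniq YS by (intro ex1I[of _ y]) (auto simp: y_def)
qed

lemma only_uvz_lconst: "only_uvz (lconst c)"
  by (simp add: only_uvz_def lconst_def)

lemma only_uvz_lpow: "i \<notin> {Va, Vx} \<Longrightarrow> only_uvz (lpow i k)"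
  by (auto simp: only_uvz_def lpow_def lookup_single when_def)

lemma only_uvz_add: "only_uvz f \<Longrightarrow> only_uvz g \<Longrightarrow> only_uvz (f + g)"
  using Poly_Mapping.keys_add[of f g] by (auto simp: only_uvz_def)

lemma only_uvz_diff: "only_uvz f \<Longrightarrow> only_uvz g \<Longrightarrow> only_uvz (f - g)"
  using Poly_Mapping.keys_diff[of f g] by (auto simp: only_uvz_def)

lemma only_uvz_mult:
  assumes "only_uvz f" "only_uvz g"
  shows "only_uvz (f * g)"
  unfolding only_uvz_def
proof
  fix e assume "e \<in> Poly_Mapping.keys (f * g)"
  then obtain d d' where "e = d + d'" "d \<in> Poly_Mapping.keys f" "d' \<in> Poly_Mapping.keys g"
    using Poly_Mapping.keys_mult[of f g] by blast
  then show "Poly_Mapping.lookup e Va = 0 \<and> Poly_Mapping.lookup e Vx = 0"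
    using assms by (auto simp: only_uvz_def lookup_add)
qed

theorem solution_ex1: "\<exists>!y :: 'k::field_char_0 laurent fps. is_solution y"
proof -
  define N :: "'k laurent fps" where "N = Abs_fps (\<lambda>n. lconst ((-1)^n / fact n))"
  define F :: "'k laurent fps" where "F = (fps_const (lvar Vu - 1) + fps_const (lvar Vu) * fps_X) * N"
  define w :: "'k laurent fps" where "w = fps_const (lvar Vu - 1) + fps_const (lvar Vv * lvar Vz) * fps_X"
  have m1: "lconst (- 1) = (- 1 :: 'k laurent)"
    by (simp only: lconst_def single_uminus single_one)
  have m1n: "lconst ((- 1) ^ n) = ((- 1) ^ n :: 'k laurent)" for n
  proof (induction n)
    case (Suc n)
    then show ?case by (simp only: power_Suc lconst_mult m1)
  qed simp
  have lexp: "lexp (- y) = N oo y" for y :: "'k laurent fps"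
  proof (rule fps_ext)
    fix n
    have "lconst (1 / fact i) * ((- y) ^ i) $ n = lconst ((-1)^i / fact i) * (y ^ i) $ n" for i
    proof -
      have "((- y) ^ i) $ n = (-1)^i * (y ^ i) $ n"
        by (cases "even i") simp_all
      moreover have "lconst ((-1)^i / fact i) = (lconst (1 / fact i) * (-1)^i :: 'k laurent)"
        using lconst_mult[of "1 / fact i" "(-1)^i :: 'k"] by (simp add: m1n)
      ultimately show ?thesis by (simp add: mult.assoc)
    qed
    then show "lexp (- y) $ n = (N oo y) $ n"
      by (simp add: lexp_def N_def fps_compose_nth)
  qed
  have unit: "linv Vu * lvar Vu = (1 :: 'k laurent)"
    using lpow_add[of Vu "-1" 1, where ?'a = 'k] by simp
  have eq: "(fps_const (1 - linv Vu) + y) * fps_const (lvar Vu) * lexp (- y) = F oo y"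
    if "y $ 0 = 0" for y :: "'k laurent fps"
  proof -
    have "fps_X oo y = y"
      using that by (auto simp: fps_X_fps_compose fps_eq_iff)
    then have "F oo y = (fps_const (lvar Vu - 1) + fps_const (lvar Vu) * y) * (N oo y)"
      using that by (simp add: F_def fps_compose_mult_distrib fps_compose_add_distrib)
    moreover have "(fps_const (1 - linv Vu) + y) * fps_const (lvar Vu)
        = fps_const ((1 - linv Vu) * lvar Vu) + fps_const (lvar Vu) * y"
      by (simp only: distrib_right fps_const_mult mult.commute[of y])
    moreover have "(1 - linv Vu) * lvar Vu = lvar Vu - (1 :: 'k laurent)"
      by (simp add: left_diff_distrib unit)
    ultimately show ?thesis by (simp add: lexp)
  qed
  let ?S = "Collect (only_uvz :: 'k laurent \<Rightarrow> bool)"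
  have S0: "0 \<in> ?S" and S1: "1 \<in> ?S"
    using only_uvz_lconst[of 0] only_uvz_lconst[of 1] by simp_all
  have F_nth: "F $ n = (lvar Vu - 1) * N $ n + (if n = 0 then 0 else lvar Vu * N $ (n - 1))" for n
    by (simp add: F_def distrib_right mult.assoc)
  have "\<exists>!y. y $ 0 = 0 \<and> (\<forall>n. y $ n \<in> ?S) \<and> F oo y = w"
  proof (rule fps_compose_solve_ex1)
    show "F $ 1 = 1" by (simp add: F_nth N_def m1 algebra_simps)
    show "F $ 0 = w $ 0" by (simp add: F_nth N_def w_def)
    show "F $ n \<in> ?S" for n
      using S0 S1 unfolding F_nth
      by (auto simp: N_def intro!: only_uvz_add only_uvz_mult only_uvz_diff only_uvz_lpow only_uvz_lconst)
    show "w $ n \<in> ?S" for n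
      using S0 S1
      by (auto simp: w_def fps_X_def intro!: only_uvz_add only_uvz_mult only_uvz_diff only_uvz_lpow)
  qed (use S0 S1 in \<open>auto intro: only_uvz_add only_uvz_mult only_uvz_diff\<close>)
  moreover have "is_solution y \<longleftrightarrow> y $ 0 = 0 \<and> (\<forall>n. y $ n \<in> ?S) \<and> F oo y = w" for y
    using eq by (auto simp: is_solution_def w_def)
  ultimately show ?thesis by simp
qed

end

end

theory Submission
  imports Defs
begin

text \<open>Write \<open>A, X, Z, V, U\<close> for the generating functions of the variables. \<open>Gen\<close> is a ring
  homomorphism that turns \<open>D\<close> into \<open>d/dt\<close>, and \<open>D\<close> kills \<open>x/z\<close> and \<open>v/u\<close>, so \<open>X = (x/z) Z\<close> and
  \<open>V = (v/u) U\<close>. Let \<open>Y\<close> be the antiderivative of \<open>V Z\<close> without constant term. From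
  \<open>Z' = Z Y'\<close> and \<open>(1/U)' = - Y'\<close> one gets \<open>e^(-Y) Z = z\<close> and \<open>V (1 - u Y) = v\<close>; hence
  \<open>(u - 1 + u Y) e^(-Y)\<close> has derivative \<open>V (1 - u Y) e^(-Y) Z = v z\<close>, so \<open>Y\<close> is the unique
  solution \<open>y\<close>. Finally \<open>A' = A X V = (x/z) A Y'\<close> gives \<open>A\<close>.\<close>

context
  includes fps_syntax
begin

section \<open>Differential equations and the exponential over Laurent polynomials\<close>

text \<open>The coefficient of index \<open>m\<close> of \<open>P * g\<close> involves only
  \<open>P $ k\<close> with \<open>k \<le> m\<close>, so the equation determines
  \<open>P $ Suc m\<close> after cancelling \<open>Suc m\<close>. Applied to a difference, this
  gives uniqueness for linear equations.\<close>

lemma fps_linear_ode_zero: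
  fixes P g :: "'r::{idom,semiring_char_0} fps"
  assumes ode: "fps_deriv P = P * g" and init: "P $ 0 = 0"
  shows "P = 0"
proof (rule fps_ext)
  fix n
  show "P $ n = 0 $ n"
  proof (induction n rule: less_induct)
    case (less n)
    show ?case
    proof (cases n)
      case (Suc m)
      have "of_nat (Suc m) * P $ Suc m = (P * g) $ m"
        using arg_cong[OF ode, of "\<lambda>f. f $ m"] by (simp add: fps_deriv_nth)
      also have "\<dots> = 0"
        using less Suc by (auto simp: fps_mult_nth intro!: sum.neutral)
      finally show ?thesis
        unfolding Suc by (simp del: of_nat_Suc)
    qed (use init in simp)
  qed
qed

lemma lconst_of_nat: "lconst (of_nat n) = (of_nat n :: 'k::field_char_0 laurent)"
  by (induction n) (simp_all add: lconst_add)

text \<open>Makes \<open>fps_deriv\<close> a plain index shift on coefficients divided by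
  \<open>fact n\<close>, as in \<open>lexp\<close> and \<open>Gen\<close>.\<close>

lemma of_nat_lconst_inverse_fact:
  "of_nat (Suc n) * lconst (1 / fact (Suc n)) = (lconst (1 / fact n) :: 'k::field_char_0 laurent)"
  by (simp only: lconst_of_nat[symmetric] lconst_mult[symmetric]) (simp del: of_nat_Suc)

text \<open>The chain rule, since the outer series is its own derivative.\<close>

lemma fps_deriv_lexp:
  assumes "f $ 0 = 0"
  shows "fps_deriv (lexp f) = lexp f * fps_deriv f"
proof -
  have "fps_deriv (Abs_fps (\<lambda>n. lconst (1 / fact n))) = Abs_fps (\<lambda>n. lconst (1 / fact n) :: 'a laurent)"
    by (rule fps_ext) (simp add: fps_deriv_nth of_nat_lconst_inverse_fact del: fact_Suc of_nat_Suc)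
  then show ?thesis
    by (simp add: lexp_def fps_compose_deriv[OF assms])
qed

lemma lexp_nth_0 [simp]: "lexp f $ 0 = 1"
  by (simp add: lexp_def)

lemma lpow_inverse: "lpow i k * lpow i (- k) = (1 :: 'k::field_char_0 laurent)"
  by (simp flip: lpow_add)

section \<open>Generating functions of an arbitrary derivation\<close>

context
  fixes D :: "'k::field_char_0 laurent \<Rightarrow> 'k laurent"
  assumes D: "is_derivation D"
begin

lemma derivation_add: "D (f + g) = D f + D g"
  and derivation_scale: "D (lconst c * f) = lconst c * D f"
  and derivation_mult: "D (f * g) = D f * g + f * D g"
  using D unfolding is_derivation_def by blast+

lemma derivation_0: "D 0 = 0"
  using derivation_scale[of 0 0] by simp

lemma derivation_1: "D 1 = 0"
  using derivation_mult[of 1 1] by simp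

text \<open>Apply \<open>D\<close> to \<open>lvar i * linv i = 1\<close> and multiply by
  \<open>linv i\<close>.\<close>

lemma derivation_linv: "D (linv i) = - (linv i * linv i * D (lvar i))"
proof -
  have 1: "lvar i * linv i = (1 :: 'k laurent)"
    by (rule lpow_inverse)
  then have "D (lvar i) * linv i + lvar i * D (linv i) = 0"
    using derivation_mult[of "lvar i" "linv i"] derivation_1 by simp
  then have "linv i * (D (lvar i) * linv i + lvar i * D (linv i)) = 0" by simp
  then have "linv i * linv i * D (lvar i) + (lvar i * linv i) * D (linv i) = 0"
    by (simp add: algebra_simps)
  then show ?thesis
    by (simp add: 1 eq_neg_iff_add_eq_0 add.commute)
qed

lemma Gen_nth_0 [simp]: "Gen D f $ 0 = f"
  by (simp add: Gen_def)

lemma fps_deriv_Gen: "fps_deriv (Gen D f) = Gen D (D f)"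
  by (rule fps_ext)
    (simp add: Gen_def fps_deriv_nth funpow_swap1 mult.assoc[symmetric] of_nat_lconst_inverse_fact
      del: fact_Suc of_nat_Suc)

lemma Gen_add: "Gen D (f + g) = Gen D f + Gen D g"
proof -
  have "(D ^^ n) (f + g) = (D ^^ n) f + (D ^^ n) g" for n
    by (induction n) (simp_all add: derivation_add)
  then show ?thesis
    by (simp add: Gen_def fps_eq_iff distrib_left)
qed

text \<open>Differentiation replaces a binomial convolution: both sides obey the Leibniz rule, so
  coefficient \<open>Suc n\<close> for \<open>f, g\<close> reduces to coefficient \<open>n\<close>
  for the pairs \<open>D f, g\<close> and \<open>f, D g\<close>. Hence \<open>f\<close> and
  \<open>g\<close> vary in the induction.\<close>

lemma Gen_mult: "Gen D (f * g) = Gen D f * Gen D g"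
proof (rule fps_ext)
  fix n
  show "Gen D (f * g) $ n = (Gen D f * Gen D g) $ n"
  proof (induction n arbitrary: f g)
    case (Suc n)
    have deriv: "of_nat (Suc n) * F $ Suc n = fps_deriv F $ n" for F :: "'k laurent fps"
      by (simp add: fps_deriv_nth)
    have "of_nat (Suc n) * Gen D (f * g) $ Suc n = of_nat (Suc n) * (Gen D f * Gen D g) $ Suc n"
      unfolding deriv by (simp add: fps_deriv_Gen derivation_mult Gen_add Suc algebra_simps)
    then show ?case
      by (simp del: of_nat_Suc)
  qed simp
qed

lemma Gen_constant:
  assumes "D f = 0"
  shows "Gen D f = fps_const f"
proof -
  have "(D ^^ n) f = (if n = 0 then f else 0)" for n
    by (induction n) (simp_all add: assms derivation_0)
  then show ?thesis
    by (simp add: Gen_def fps_eq_iff)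
qed

end

section \<open>The candidate solution and the variables in its coefficients\<close>

text \<open>Working with sums of products of the variables themselves, instead of all of \<open>only_uvz\<close>,
  makes invariance under \<open>D\<close> a plain rule induction: no negative exponents occur.\<close>

inductive_set uvz_span :: "'k::field_char_0 laurent set" where
  var: "i \<in> {Vz, Vv, Vu} \<Longrightarrow> lvar i \<in> uvz_span"
| add: "f \<in> uvz_span \<Longrightarrow> g \<in> uvz_span \<Longrightarrow> f + g \<in> uvz_span"
| mult: "f \<in> uvz_span \<Longrightarrow> g \<in> uvz_span \<Longrightarrow> f * g \<in> uvz_span"

lemma uvz_span_only_uvz: "f \<in> uvz_span \<Longrightarrow> only_uvz f"
  by (induction rule: uvz_span.induct) (auto intro: only_uvz_lpow only_uvz_add only_uvz_mult)

lemma uvz_span_grammar_derivation: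
  assumes "is_grammar_derivation D" "f \<in> uvz_span"
  shows "D f \<in> uvz_span"
proof -
  have D: "is_derivation D"
    using assms(1) by (simp add: is_grammar_derivation_def)
  show ?thesis
    using assms(2)
  proof (induction rule: uvz_span.induct)
    case (var i)
    then show ?case
      using assms(1)
      by (auto simp: is_grammar_derivation_def power2_eq_square
          intro!: uvz_span.mult uvz_span.var)
  qed (auto simp: derivation_add[OF D] derivation_mult[OF D] intro: uvz_span.intros)
qed

text \<open>The series \<open>Y\<close>: the termwise integral of \<open>V Z\<close>, with the case
  \<open>n = 0\<close> fixing the constant of integration.\<close>

definition grammar_solution :: "('k::field_char_0 laurent \<Rightarrow> 'k laurent) \<Rightarrow> 'k laurent fps" where
  "grammar_solution D =
    Abs_fps (\<lambda>n. if n = 0 then 0 else lconst (1 / of_nat n) * Gen D (lvar Vv * lvar Vz) $ (n - 1))"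

lemma grammar_solution_nth_0 [simp]: "grammar_solution D $ 0 = 0"
  by (simp add: grammar_solution_def)

lemma fps_deriv_grammar_solution:
  "fps_deriv (grammar_solution D) = Gen D (lvar Vv * lvar Vz)"
proof (rule fps_ext)
  fix n
  have "of_nat (Suc n) * lconst (1 / of_nat (Suc n)) = (1 :: 'a laurent)"
    by (simp only: lconst_of_nat[symmetric] lconst_mult[symmetric]) (simp del: of_nat_Suc)
  then show "fps_deriv (grammar_solution D) $ n = Gen D (lvar Vv * lvar Vz) $ n"
    by (simp add: grammar_solution_def fps_deriv_nth mult.assoc[symmetric] del: of_nat_Suc)
qed

lemma only_uvz_grammar_solution:
  assumes "is_grammar_derivation D"
  shows "only_uvz (grammar_solution D $ n)"
proof -
  have "(D ^^ m) (lvar Vv * lvar Vz) \<in> uvz_span" for m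
    by (induction m)
      (auto intro: uvz_span.intros uvz_span_grammar_derivation[OF assms])
  then show ?thesis
    using only_uvz_lconst[of 0]
    by (auto simp: grammar_solution_def Gen_def
        intro!: only_uvz_mult[OF only_uvz_lconst] intro: uvz_span_only_uvz)
qed

section \<open>Generating functions of the variables under the grammar\<close>

context
  fixes D :: "'k::field_char_0 laurent \<Rightarrow> 'k laurent"
  assumes D: "is_grammar_derivation D"
begin

lemma grammar_derivation: "is_derivation D"
  using D by (simp add: is_grammar_derivation_def)

lemmas grammar_rules = D[unfolded is_grammar_derivation_def, THEN conjunct2]

lemma Gen_vz: "Gen D (lvar Vv * lvar Vz) = Gen D (lvar Vv) * Gen D (lvar Vz)"
  by (rule Gen_mult[OF grammar_derivation])

lemma Gen_x: "Gen D (lvar Vx) = fps_const (lvar Vx * linv Vz) * Gen D (lvar Vz)"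
proof -
  \<comment> \<open>The vanishing factor \<open>1 - lvar Vz * linv Vz\<close> is kept, so that
    expanding proves the identity without cancelling inverses; \<open>lpow_inverse\<close> then
    makes it zero.\<close>
  have "D (lvar Vx * linv Vz) = (lvar Vx * linv Vz) * lvar Vv * lvar Vz * (1 - lvar Vz * linv Vz)"
    by (simp add: derivation_mult[OF grammar_derivation] derivation_linv[OF grammar_derivation]
        grammar_rules power2_eq_square algebra_simps)
  then have "Gen D (lvar Vx * linv Vz) = fps_const (lvar Vx * linv Vz)"
    by (intro Gen_constant[OF grammar_derivation]) (simp add: lpow_inverse)
  moreover have "lvar Vx * linv Vz * lvar Vz = (lvar Vx :: 'k laurent)"
    by (simp add: mult.assoc mult.commute[of "linv Vz"] lpow_inverse)
  ultimately show ?thesis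
    using Gen_mult[OF grammar_derivation, of "lvar Vx * linv Vz" "lvar Vz"] by (simp only:)
qed

text \<open>Since \<open>D\<close> sends \<open>1/u\<close> to \<open>- v z\<close>, the sum of
  \<open>1/U\<close> and \<open>Y\<close> is constant; its value at \<open>t = 0\<close> is
  \<open>1/u\<close>.\<close>

lemma Gen_linv_u: "Gen D (linv Vu) = fps_const (linv Vu) - grammar_solution D"
proof -
  have "D (linv Vu) = - ((lvar Vu * linv Vu) * (lvar Vu * linv Vu) * (lvar Vv * lvar Vz))"
    by (simp add: derivation_linv[OF grammar_derivation] grammar_rules power2_eq_square ac_simps)
  then have inv: "D (linv Vu) + lvar Vv * lvar Vz = 0"
    by (simp add: lpow_inverse)
  have "fps_deriv (Gen D (linv Vu) + grammar_solution D) = Gen D (D (linv Vu) + lvar Vv * lvar Vz)"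
    by (simp add: fps_deriv_Gen[OF grammar_derivation] Gen_add[OF grammar_derivation]
        fps_deriv_grammar_solution)
  also have "\<dots> = 0"
    by (simp add: inv Gen_constant[OF grammar_derivation] derivation_0[OF grammar_derivation])
  finally have "Gen D (linv Vu) + grammar_solution D
      = fps_const ((Gen D (linv Vu) + grammar_solution D) $ 0)"
    by (rule iffD1[OF fps_deriv_eq_0_iff])
  also have "(Gen D (linv Vu) + grammar_solution D) $ 0 = linv Vu"
    by (simp add: Gen_nth_0[OF grammar_derivation])
  finally show ?thesis
    by (simp only: eq_diff_eq)
qed

text \<open>Invariance of \<open>v/u\<close> gives \<open>V (1/u - Y) = v/u\<close>; multiply by
  \<open>u\<close>.\<close>

lemma Gen_v_solution:
  "Gen D (lvar Vv) * (1 - fps_const (lvar Vu) * grammar_solution D) = fps_const (lvar Vv)"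
proof -
  have u: "fps_const (lvar Vu) * fps_const (linv Vu) = (1 :: 'k laurent fps)"
    by (simp add: lpow_inverse)
  have "D (lvar Vv * linv Vu) =
      lvar Vv * lvar Vv * lvar Vz * lvar Vu * linv Vu * (1 - lvar Vu * linv Vu)"
    by (simp add: derivation_mult[OF grammar_derivation] derivation_linv[OF grammar_derivation]
        grammar_rules power2_eq_square algebra_simps)
  then have "Gen D (lvar Vv * linv Vu) = fps_const (lvar Vv * linv Vu)"
    by (intro Gen_constant[OF grammar_derivation]) (simp add: lpow_inverse)
  then have vu: "Gen D (lvar Vv) * (fps_const (linv Vu) - grammar_solution D)
      = fps_const (lvar Vv) * fps_const (linv Vu)"
    by (simp add: Gen_mult[OF grammar_derivation] Gen_linv_u)
  have "Gen D (lvar Vv) * (1 - fps_const (lvar Vu) * grammar_solution D)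
      = fps_const (lvar Vu) * (Gen D (lvar Vv) * (fps_const (linv Vu) - grammar_solution D))"
    unfolding u[symmetric] by (simp only: algebra_simps)
  also have "\<dots> = fps_const (lvar Vv) * (fps_const (lvar Vu) * fps_const (linv Vu))"
    unfolding vu by (simp only: ac_simps)
  finally show ?thesis
    unfolding u by simp
qed

lemma lexp_neg_solution_Gen_z:
  "lexp (- grammar_solution D) * Gen D (lvar Vz) = fps_const (lvar Vz)"
proof -
  have z: "fps_deriv (Gen D (lvar Vz)) = Gen D (lvar Vv) * Gen D (lvar Vz) * Gen D (lvar Vz)"
    by (simp add: fps_deriv_Gen[OF grammar_derivation] grammar_rules power2_eq_square
        Gen_mult[OF grammar_derivation] mult.assoc)
  have "fps_deriv (lexp (- grammar_solution D) * Gen D (lvar Vz)) = 0"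
    by (simp add: z fps_deriv_lexp fps_deriv_grammar_solution Gen_vz algebra_simps)
  then have "lexp (- grammar_solution D) * Gen D (lvar Vz)
      = fps_const ((lexp (- grammar_solution D) * Gen D (lvar Vz)) $ 0)"
    by (rule iffD1[OF fps_deriv_eq_0_iff])
  also have "(lexp (- grammar_solution D) * Gen D (lvar Vz)) $ 0 = lvar Vz"
    by (simp add: Gen_nth_0[OF grammar_derivation])
  finally show ?thesis .
qed

lemma is_solution_grammar_solution: "is_solution (grammar_solution D)"
proof -
  define Y where "Y = grammar_solution D"
  define E where "E = lexp (- Y)"
  define V Z where "V = Gen D (lvar Vv)" and "Z = Gen D (lvar Vz)"
  define u where "u = fps_const (lvar Vu :: 'k laurent)"
  define L where "L = (fps_const (1 - linv Vu) + Y) * u * E"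
  define R where "R = fps_const (lvar Vu - 1) + fps_const (lvar Vv * lvar Vz :: 'k laurent) * fps_X"
  have Y': "fps_deriv Y = V * Z"
    by (simp add: Y_def V_def Z_def fps_deriv_grammar_solution Gen_vz)
  have E': "fps_deriv E = - (E * (V * Z))"
    using fps_deriv_lexp[of "- Y"] by (simp add: E_def Y') (simp add: Y_def)
  have "(1 - linv Vu) * lvar Vu = lvar Vu - (1 :: 'k laurent)"
    by (simp add: left_diff_distrib mult.commute[of "linv Vu"] lpow_inverse)
  then have "fps_const (1 - linv Vu) * u = u - 1"
    by (simp only: u_def fps_const_mult fps_const_sub flip: fps_const_1_eq_1)
  then have L: "L = (u - 1 + u * Y) * E"
    by (simp only: L_def distrib_right mult.commute[of Y])
  \<comment> \<open>The product rule gives \<open>u Y' E - (u - 1 + u Y) E Y'\<close>, where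
    \<open>u - u\<close> cancels and leaves \<open>(1 - u Y) E Y'\<close>.\<close>
  have "fps_deriv L = (V * (1 - u * Y)) * (E * Z)"
    by (simp add: L E' Y' u_def algebra_simps)
  also have "\<dots> = fps_const (lvar Vv * lvar Vz)"
    using Gen_v_solution lexp_neg_solution_Gen_z by (simp add: V_def Z_def E_def Y_def u_def)
  also have "\<dots> = fps_deriv R"
    by (simp add: R_def)
  finally have "L = fps_const (L $ 0 - R $ 0) + R"
    by (simp only: fps_deriv_eq_iff)
  moreover have "L $ 0 = R $ 0"
    by (simp add: L R_def E_def Y_def u_def)
  ultimately have "L = R" by simp
  then show ?thesis
    using only_uvz_grammar_solution[OF D]
    by (simp add: is_solution_def L_def R_def E_def Y_def u_def)
qed

text \<open>Both sides solve \<open>A' = A c Y'\<close> with \<open>c = x/z\<close> and start at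
  \<open>a\<close>, so their difference \<open>P\<close> solves the same equation from
  \<open>0\<close>.\<close>

lemma Gen_a: "Gen D (lvar Va) =
  fps_const (lvar Va) * lexp (fps_const (lvar Vx * linv Vz) * grammar_solution D)"
proof -
  define c where "c = fps_const (lvar Vx * linv Vz :: 'k laurent)"
  define P where "P = Gen D (lvar Va) - fps_const (lvar Va) * lexp (c * grammar_solution D)"
  have a: "fps_deriv (Gen D (lvar Va)) = Gen D (lvar Va) * (c * Gen D (lvar Vv * lvar Vz))"
    by (simp add: fps_deriv_Gen[OF grammar_derivation] grammar_rules
        Gen_mult[OF grammar_derivation] Gen_x c_def ac_simps)
  have "fps_deriv (lexp (c * grammar_solution D))
      = lexp (c * grammar_solution D) * (c * Gen D (lvar Vv * lvar Vz))"
    by (subst fps_deriv_lexp) (simp_all add: c_def fps_deriv_grammar_solution)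
  then have "fps_deriv P = P * (c * Gen D (lvar Vv * lvar Vz))"
    by (simp add: P_def a algebra_simps)
  then have "P = 0"
    by (rule fps_linear_ode_zero) (simp add: P_def Gen_nth_0[OF grammar_derivation])
  then show ?thesis by (simp add: P_def c_def)
qed

end

end

theorem theorem3p5:
  fixes D :: "'k::field_char_0 laurent \<Rightarrow> 'k laurent"
    and y :: "'k laurent fps"
  assumes "is_grammar_derivation D"
    and "is_solution y"
  shows "Gen D (lvar Va) = fps_const (lvar Va) * lexp (fps_const (lvar Vx * linv Vz) * y)"
proof -
  have "y = grammar_solution D"
    using solution_ex1 assms(2) is_solution_grammar_solution[OF assms(1)] by blast
  then show ?thesis
    using Gen_a[OF assms(1)] by simp
qed

end
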